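(* Let $r\mapsto D^r f(0)$ ($r\ge 0$) be the order data at $0$ of a function $f$ for an admissible family of fractional derivatives, and let $\phi(r,x)=\dfrac{D^r f(0)\,x^r}{\Gamma(r+1)}$. Fix real $x>0$ and an integer $m\ge 1$. Assume that $r\mapsto\phi(r,x)$ has $2m$ continuous derivatives on $[0,\infty)$, that $\phi(\cdot,x)$ and $\partial_r^{2m}\phi(\cdot,x)$ are integrable on $[0,\infty)$, that $\sum_{n=0}^\infty \phi(n,x)$ converges, and that $$\partial_r^j\phi(r,x)\longrightarrow 0\quad (r\to\infty),\qquad 0\le j\le 2m-1 .$$ Then $$\sum_{n=0}^\infty \phi(n,x)=\int_0^\infty \phi(r,x)\,dr+\frac12\phi(0,x)-\sum_{k=1}^m \frac{B_{2k}}{(2k)!}\frac{\partial^{2k-1}\phi}{\partial r^{2k-1}}(0,x)+R_m(x),$$ where $$R_m(x)=-\frac{1}{(2m)!}\int_0^\infty \widetilde B_{2m}(r)\,\frac{\partial^{2m}\phi}{\partial r^{2m}}(r,x)\,dr,\qquad \widetilde B_{2m}(r)=B_{2m}\bigl(r-\lfloor r\rfloor\bigr).$$ If, in addition, the Maclaurin series of $f$ converges to $f(x)$ at the point $x$, then $$f(x)=\mathcal S[f](x)+\frac12 f(0)-\sum_{k=1}^m \frac{B_{2k}}{(2k)!}\frac{\partial^{2k-1}\phi}{\partial r^{2k-1}}(0,x)+R_m(x).$$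
   Context: A family $\{D^r\}_{r\ge 0}$ of fractional differentiation operators is called admissible for $f$ if (1) $D^n f(0)=f^{(n)}(0)$ for every integer $n\ge 0$; (2) $D^\alpha D^\beta=D^{\alpha+\beta}$ for $\alpha,\beta\ge 0$; (3) $D^r f(0)$ exists and is finite for every real $r\ge 0$. Here $D^r f(0)$ means $D^r f$ evaluated at $0$; only the function $r\mapsto D^r f(0)$ enters below. For real $x>0$ such that the integral converges, the spectral reconstruction operator is $$\mathcal S[f](x):=\int_0^\infty \frac{D^r f(0)\,x^r}{\Gamma(r+1)}\,dr=\int_0^\infty\phi(r,x)\,dr .$$ $B_{j}(t)$ denotes the $j$-th Bernoulli polynomial, $B_j=B_j(0)$ the $j$-th Bernoulli number, and $\widetilde B_{2m}$ the periodic Bernoulli function. Derivatives in $r$ at $r=0$ are one-sided (right) derivatives. The Maclaurin series of $f$ at $x$ is $\sum_{n\ge 0} f^{(n)}(0)x^n/n!$. *)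

theory Defs
  imports "HOL-Analysis.Analysis"
begin

text \<open>
  Scalars are of type \<open>'a :: {real_normed_field, euclidean_space}\<close>, which has both \<open>real\<close> and
  \<open>complex\<close> as instances.
\<close>

text \<open>
  Iterated derivative relative to \<open>S\<close>. For \<open>S = UNIV\<close> it is the ordinary one; for \<open>S = {0..}\<close> it
  is the ordinary derivative at \<open>t > 0\<close> and the right derivative at \<open>t = 0\<close>. As
  \<^const>\<open>vector_derivative\<close> is total, existence has to be stated separately.
\<close>

definition nth_deriv :: "real set \<Rightarrow> nat \<Rightarrow> (real \<Rightarrow> 'a::real_normed_vector) \<Rightarrow> real \<Rightarrow> 'a" where
  "nth_deriv S n g = ((\<lambda>h t. vector_derivative h (at t within S)) ^^ n) g"

definition cont_diff_on :: "real set \<Rightarrow> nat \<Rightarrow> (real \<Rightarrow> 'a::real_normed_vector) \<Rightarrow> bool" where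
  "cont_diff_on S k g \<longleftrightarrow>
     (\<forall>j<k. \<forall>t\<in>S. nth_deriv S j g differentiable (at t within S)) \<and>
     (\<forall>j\<le>k. continuous_on S (nth_deriv S j g))"

text \<open>
  All derivatives of \<open>f\<close> at 0 exist. The neighbourhood of 0 on which the \<open>n\<close>-th derivative is
  differentiable may depend on \<open>n\<close>.
\<close>

definition inf_differentiable_at_0 :: "(real \<rightharpoonup> 'a::real_normed_vector) \<Rightarrow> bool" where
  "inf_differentiable_at_0 f \<longleftrightarrow>
     0 \<in> interior (dom f) \<and>
     (\<forall>n. \<forall>\<^sub>F t in nhds 0. nth_deriv UNIV n (the \<circ> f) differentiable (at t))"

text \<open>
  Functions are partial, so that the existence of \<open>D\<^sup>r f(0)\<close> is a genuine condition: it says that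
  \<open>D r f\<close> is defined at 0. A defined value lies in \<open>'a\<close> and hence is finite. The operators \<open>D r\<close>
  act on a class \<open>F\<close> of functions that contains \<open>f\<close> and is closed under them; what \<open>D\<close> does for
  negative orders or outside \<open>F\<close> is irrelevant.
\<close>

definition admissible ::
  "(real \<rightharpoonup> 'a::real_normed_vector) set \<Rightarrow> (real \<Rightarrow> (real \<rightharpoonup> 'a) \<Rightarrow> (real \<rightharpoonup> 'a)) \<Rightarrow> (real \<rightharpoonup> 'a) \<Rightarrow> bool"
  where
  "admissible F D f \<longleftrightarrow>
     f \<in> F \<and> (\<forall>r\<ge>0. \<forall>g\<in>F. D r g \<in> F) \<and>
     inf_differentiable_at_0 f \<and>
     (\<forall>n::nat. D (real n) f 0 = Some (nth_deriv UNIV n (the \<circ> f) 0)) \<and>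
     (\<forall>\<alpha>\<ge>0. \<forall>\<beta>\<ge>0. \<forall>g\<in>F. D \<alpha> (D \<beta> g) = D (\<alpha> + \<beta>) g) \<and>
     (\<forall>r\<ge>0. 0 \<in> dom (D r f))"

definition phi ::
  "(real \<Rightarrow> (real \<rightharpoonup> 'a::real_normed_vector) \<Rightarrow> (real \<rightharpoonup> 'a)) \<Rightarrow> (real \<rightharpoonup> 'a) \<Rightarrow> real \<Rightarrow> real \<Rightarrow> 'a"
  where "phi D f r x = (x powr r / Gamma (r + 1)) *\<^sub>R the (D r f 0)"

abbreviation phi_deriv ::
  "nat \<Rightarrow> (real \<Rightarrow> (real \<rightharpoonup> 'a::real_normed_vector) \<Rightarrow> (real \<rightharpoonup> 'a)) \<Rightarrow> (real \<rightharpoonup> 'a) \<Rightarrow> real \<Rightarrow> real \<Rightarrow> 'a"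
  where "phi_deriv j D f r x \<equiv> nth_deriv {0..} j (\<lambda>s. phi D f s x) r"

definition spectral_reconstruction ::
  "(real \<Rightarrow> (real \<rightharpoonup> 'a::euclidean_space) \<Rightarrow> (real \<rightharpoonup> 'a)) \<Rightarrow> (real \<rightharpoonup> 'a) \<Rightarrow> real \<Rightarrow> 'a"
  where "spectral_reconstruction D f x = integral {0..} (\<lambda>r. phi D f r x)"

text \<open>Bernoulli numbers with \<open>B\<^sub>1 = -1/2\<close>, from \<open>(\<Sum>k\<le>n. (n+1 choose k) B\<^sub>k) = 0\<close> for \<open>n \<ge> 1\<close>.\<close>

fun bernoulli :: "nat \<Rightarrow> real" where
  "bernoulli n =
     (if n = 0 then 1 else - (\<Sum>k<n. real ((n + 1) choose k) * bernoulli k) / real (n + 1))"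

declare bernoulli.simps [simp del]

definition bernpoly :: "nat \<Rightarrow> real \<Rightarrow> real" where
  "bernpoly n t = (\<Sum>k\<le>n. real (n choose k) * bernoulli k * t ^ (n - k))"

lemma bernpoly_0: "bernpoly n 0 = bernoulli n"
proof -
  have "bernpoly n 0 = (\<Sum>k\<in>{n}. real (n choose k) * bernoulli k * 0 ^ (n - k))"
    unfolding bernpoly_def by (rule sum.mono_neutral_right) auto
  then show ?thesis by simp
qed

definition periodic_bernoulli :: "nat \<Rightarrow> real \<Rightarrow> real" where
  "periodic_bernoulli n t = bernpoly n (t - of_int \<lfloor>t\<rfloor>)"

definition remainder ::
  "nat \<Rightarrow> (real \<Rightarrow> (real \<rightharpoonup> 'a::euclidean_space) \<Rightarrow> (real \<rightharpoonup> 'a)) \<Rightarrow> (real \<rightharpoonup> 'a) \<Rightarrow> real \<Rightarrow> 'a"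
  where
  "remainder m D f x =
     - (1 / fact (2 * m)) *\<^sub>R
       integral {0..} (\<lambda>r. periodic_bernoulli (2 * m) r *\<^sub>R phi_deriv (2 * m) D f r x)"

end

theory Submission
  imports Defs
begin

text \<open>
  Since \<open>B\<^sub>j\<^sub>+\<^sub>1(t) / (j+1)!\<close> is a primitive of \<open>B\<^sub>j(t) / j!\<close>, integrating \<open>\<phi> = B\<^sub>0 \<phi>\<close> by parts
  \<open>2m\<close> times on a unit interval leaves boundary terms and a remainder. The terms with odd index
  \<open>\<ge> 3\<close> vanish, the others telescope when the intervals \<open>[n, n+1]\<close> are added up, and letting the
  right end point tend to infinity removes the boundary terms there. Admissibility identifies
  \<open>\<phi>(n, x)\<close> with the terms of the Maclaurin series.
\<close>

section \<open>Bernoulli polynomials: derivative, end point values and symmetry\<close>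

lemma bernpoly_has_field_derivative [derivative_intros]:
  assumes "(f has_field_derivative f') (at t within S)"
  shows "((\<lambda>t. bernpoly (Suc n) (f t)) has_field_derivative
           real (Suc n) * bernpoly n (f t) * f') (at t within S)"
proof -
  have "((\<lambda>t. bernpoly (Suc n) t) has_field_derivative real (Suc n) * bernpoly n t) (at t)" for t
  proof -
    have eq: "real (Suc n choose k) * real (Suc n - k) = real (Suc n) * real (n choose k)"
      if "k \<le> n" for k
      using binomial_absorb_comp[of "Suc n" k] by (metis of_nat_mult mult.commute diff_Suc_1)
    have "((\<lambda>t. bernpoly (Suc n) t) has_field_derivative
        (\<Sum>k\<le>Suc n. real (Suc n choose k) * bernoulli k * (real (Suc n - k) * t ^ (Suc n - k - 1)))) (at t)"
      unfolding bernpoly_def by (auto intro!: derivative_eq_intros sum.cong)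
    \<comment> \<open>The summand \<open>k = Suc n\<close> has the factor
      \<open>real (Suc n - k) = 0\<close>, so the truncated exponent there is harmless.\<close>
    also have "(\<Sum>k\<le>Suc n. real (Suc n choose k) * bernoulli k * (real (Suc n - k) * t ^ (Suc n - k - 1)))
       = (\<Sum>k\<le>n. real (Suc n choose k) * bernoulli k * (real (Suc n - k) * t ^ (n - k)))"
      by (simp add: sum.atMost_Suc)
    also have "\<dots> = (\<Sum>k\<le>n. real (Suc n) * (real (n choose k) * bernoulli k * t ^ (n - k)))"
    proof (intro sum.cong refl)
      fix k assume "k \<in> {..n}"
      with eq[of k] show "real (Suc n choose k) * bernoulli k * (real (Suc n - k) * t ^ (n - k))
          = real (Suc n) * (real (n choose k) * bernoulli k * t ^ (n - k))"
        by (metis atMost_iff mult.assoc mult.left_commute)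
    qed
    finally show ?thesis by (simp add: bernpoly_def sum_distrib_left)
  qed
  from DERIV_chain2[OF this assms] show ?thesis by simp
qed

lemma continuous_on_bernpoly [continuous_intros]:
  "continuous_on S f \<Longrightarrow> continuous_on S (\<lambda>t. bernpoly n (f t))"
  unfolding bernpoly_def by (intro continuous_intros)

lemma bernpoly_order_0 [simp]: "bernpoly 0 t = 1"
  by (simp add: bernpoly_def bernoulli.simps)

lemma bernpoly_1: "bernpoly (Suc 0) t = t - 1 / 2"
  by (simp add: bernpoly_def bernoulli.simps)

text \<open>The recursion for the Bernoulli numbers says that all summands of
  \<open>bernpoly n 1\<close> except the last cancel. It starts at \<open>n = 2\<close>: the values
  of \<open>bernpoly 1\<close> at 0 and 1 are -1/2 and 1/2.\<close>

lemma bernpoly_at_1: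
  assumes "n \<ge> 2"
  shows "bernpoly n 1 = bernoulli n"
proof -
  obtain k where n: "n = Suc k" "k > 0" using assms by (cases n) auto
  have "(\<Sum>i<k. real (Suc k choose i) * bernoulli i) + real (Suc k) * bernoulli k = 0"
    using n bernoulli.simps[of k] by simp
  then show ?thesis
    by (simp add: bernpoly_def n lessThan_Suc_atMost [symmetric])
qed

lemma bernpoly_reflect: "bernpoly n (1 - t) = (-1) ^ n * bernpoly n t"
proof (induction n arbitrary: t)
  case 0
  show ?case by simp
next
  case (Suc n)
  \<comment> \<open>If \<open>d n = 0\<close>, then \<open>d (n + 1)\<close> is a constant, which is 0 because \<open>d (n + 2)\<close>, whose slope is a
    multiple of it, has equal values at 0 and 1.\<close>
  define d where "d k t = bernpoly k (1 - t) - (-1) ^ k * bernpoly k t" for k t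
  have d_deriv: "(d (Suc k) has_field_derivative - real (Suc k) * d k t) (at t)" for k t
    unfolding d_def by (auto intro!: derivative_eq_intros simp: algebra_simps)
  have "d n t = 0" for t
    using Suc.IH by (simp add: d_def)
  then have "(d (Suc n) has_field_derivative 0) (at t)" for t
    using d_deriv[of n t] by simp
  then have "d (Suc n) t = d (Suc n) 0" for t
    by (rule DERIV_isconst_all[rule_format])
  then obtain c where c: "\<And>t. d (Suc n) t = c" by metis
  define e where "e t = d (Suc (Suc n)) t + real (Suc (Suc n)) * c * t" for t
  have "(e has_field_derivative 0) (at t)" for t
    unfolding e_def using d_deriv[of "Suc n" t] c
    by (auto intro!: derivative_eq_intros simp: algebra_simps)
  then have "e 1 = e 0"
    by (rule DERIV_isconst_all[rule_format])
  moreover have "d (Suc (Suc n)) 1 = d (Suc (Suc n)) 0"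
    using bernpoly_at_1[of "Suc (Suc n)"] by (cases "even n") (simp_all add: d_def bernpoly_0)
  ultimately have "c = 0" by (simp add: e_def)
  with c[of t] show ?case by (simp add: d_def)
qed

text \<open>Reflection at 0 turns the value at 1 into \<open>- bernoulli n\<close> for odd
  \<open>n\<close>, while the recursion makes it \<open>bernoulli n\<close>.\<close>

lemma bernoulli_odd_eq_0:
  assumes "odd n" "n \<noteq> 1"
  shows "bernoulli n = 0"
proof -
  have "n \<ge> 2" using assms by (cases n) auto
  then show ?thesis
    using bernpoly_reflect[of n 0] bernpoly_at_1[of n] assms by (simp add: bernpoly_0)
qed

section \<open>Integration by parts on a unit interval\<close>

lemma bernpoly_repeated_integration_by_parts:
  fixes g :: "nat \<Rightarrow> real \<Rightarrow> 'a::banach"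
  assumes "\<And>j t. j < p \<Longrightarrow> t \<in> {a..a+1} \<Longrightarrow>
             (g j has_vector_derivative g (Suc j) t) (at t within {a..a+1})"
  shows "((\<lambda>t. g 0 t - ((-1) ^ p * bernpoly p (t - a) / fact p) *\<^sub>R g p t) has_integral
           (\<Sum>j<p. ((-1) ^ j / fact (Suc j)) *\<^sub>R
              (bernpoly (Suc j) 1 *\<^sub>R g j (a + 1) - bernpoly (Suc j) 0 *\<^sub>R g j a))) {a..a+1}"
  using assms
proof (induction p)
  case 0
  show ?case by simp
next
  case (Suc p)
  \<comment> \<open>With this \<open>c\<close>, the term in \<open>g p\<close> of the product's
    derivative cancels the remainder of order \<open>p\<close>; the term in \<open>g (Suc p)\<close>
    is the remainder of order \<open>Suc p\<close>, whose sign alternates.\<close>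
  define c :: real where "c = (-1) ^ p / fact (Suc p)"
  let ?b = "\<lambda>t. bernpoly (Suc p) (t - a)"
  have "((\<lambda>t. c *\<^sub>R (?b t *\<^sub>R g p t)) has_vector_derivative
          c *\<^sub>R (?b t *\<^sub>R g (Suc p) t + (real (Suc p) * bernpoly p (t - a)) *\<^sub>R g p t))
          (at t within {a..a+1})" if "t \<in> {a..a+1}" for t
  proof -
    have b: "(?b has_field_derivative real (Suc p) * bernpoly p (t - a)) (at t within {a..a+1})"
      by (auto intro!: derivative_eq_intros)
    show ?thesis
      by (rule has_vector_derivative_eq_rhs[OF has_vector_derivative_scaleR[OF DERIV_const
              has_vector_derivative_scaleR[OF b Suc.prems]]]) (use that in auto)
  qed
  from fundamental_theorem_of_calculus[OF _ this]
  have parts: "((\<lambda>t. c *\<^sub>R (?b t *\<^sub>R g (Suc p) t + (real (Suc p) * bernpoly p (t - a)) *\<^sub>R g p t))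
      has_integral c *\<^sub>R (bernpoly (Suc p) 1 *\<^sub>R g p (a + 1) - bernpoly (Suc p) 0 *\<^sub>R g p a)) {a..a+1}"
    by (simp add: scaleR_right_diff_distrib)
  have IH: "((\<lambda>t. g 0 t - ((-1) ^ p * bernpoly p (t - a) / fact p) *\<^sub>R g p t) has_integral
           (\<Sum>j<p. ((-1) ^ j / fact (Suc j)) *\<^sub>R
              (bernpoly (Suc j) 1 *\<^sub>R g j (a + 1) - bernpoly (Suc j) 0 *\<^sub>R g j a))) {a..a+1}"
    using Suc by simp
  have "c * real (Suc p) = (-1) ^ p / fact p"
    by (simp add: c_def divide_simps)
  then have "c * (real (Suc p) * bernpoly p (t - a)) = (-1) ^ p * bernpoly p (t - a) / fact p" for t
    by (metis mult.assoc times_divide_eq_left)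
  with has_integral_add[OF IH parts] show ?case
    by (simp add: scaleR_right_distrib c_def del: fact_Suc of_nat_Suc)
qed

text \<open>Index 0 yields the trapezoidal term, as \<open>bernpoly 1\<close> is -1/2 and 1/2 at the
  end points. Even \<open>j \<ge> 2\<close> contribute odd Bernoulli numbers, hence 0. For
  \<open>j = 2*k-1\<close> both end point values are \<open>bernoulli (2*k)\<close>, and the sign is
  negative.\<close>

lemma bernpoly_boundary_terms_eq:
  fixes u v :: "nat \<Rightarrow> 'a::real_vector"
  assumes "m \<ge> 1"
  shows "(\<Sum>j<2*m. ((-1) ^ j / fact (Suc j)) *\<^sub>R
            (bernpoly (Suc j) 1 *\<^sub>R v j - bernpoly (Suc j) 0 *\<^sub>R u j))
         = (1 / 2) *\<^sub>R (u 0 + v 0)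
           - (\<Sum>k=1..m. (bernoulli (2*k) / fact (2*k)) *\<^sub>R (v (2*k-1) - u (2*k-1)))"
  using assms
proof (induction m rule: dec_induct)
  case base
  show ?case
    using bernpoly_at_1[of 2]
    by (simp add: numeral_2_eq_2 bernpoly_1 bernpoly_0 bernoulli.simps[of "Suc 0"] bernoulli.simps[of 0] algebra_simps)
next
  case (step m)
  have "bernoulli (Suc (2*m)) = 0" "bernpoly (Suc (2*m)) 1 = 0"
    using step.hyps bernoulli_odd_eq_0[of "Suc (2*m)"] bernpoly_at_1[of "Suc (2*m)"] by auto
  moreover have "bernpoly (Suc (Suc (2*m))) 1 = bernoulli (Suc (Suc (2*m)))"
    by (simp add: bernpoly_at_1)
  ultimately show ?case
    using step.IH by (simp add: bernpoly_0 algebra_simps del: fact_Suc)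
qed

section \<open>Periodic Bernoulli functions\<close>

text \<open>The closed interval matters: at its right end the floor jumps, but for
  \<open>n \<ge> 2\<close> the polynomial agrees at 0 and 1.\<close>

lemma periodic_bernoulli_eq:
  assumes "n \<ge> 2" "t \<in> {real k..real k + 1}"
  shows "periodic_bernoulli n t = bernpoly n (t - real k)"
proof (cases "t = real k + 1")
  case True
  then have "of_int \<lfloor>t\<rfloor> = t" by simp
  with True assms show ?thesis
    by (simp add: periodic_bernoulli_def bernpoly_at_1 bernpoly_0)
next
  case False
  with assms have "\<lfloor>t\<rfloor> = int k" by (intro floor_unique) auto
  then show ?thesis by (simp add: periodic_bernoulli_def)
qed

lemma bounded_range_periodic_bernoulli: "bounded (range (periodic_bernoulli n))"
proof (rule bounded_subset)
  show "bounded (bernpoly n ` {0..1})"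
    by (intro compact_imp_bounded compact_continuous_image continuous_intros) auto
  have "periodic_bernoulli n t = bernpoly n (frac t)" "frac t \<in> {0..1}" for t
    by (simp_all add: periodic_bernoulli_def frac_def [symmetric] frac_lt_1 less_imp_le)
  then show "range (periodic_bernoulli n) \<subseteq> bernpoly n ` {0..1}"
    by blast
qed

lemma borel_measurable_periodic_bernoulli [measurable]:
  "periodic_bernoulli n \<in> borel_measurable borel"
  unfolding periodic_bernoulli_def [abs_def] bernpoly_def by measurable

text \<open>Gives absolute convergence of the remainder integral, since the Bernoulli factor is
  bounded and measurable.\<close>

lemma absolutely_integrable_periodic_bernoulli:
  fixes h :: "real \<Rightarrow> 'a::euclidean_space"
  assumes "h absolutely_integrable_on S" "S \<in> sets lebesgue"
  shows "(\<lambda>t. periodic_bernoulli n t *\<^sub>R h t) absolutely_integrable_on S"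
proof (rule absolutely_integrable_bounded_measurable_product[where h = "(*\<^sub>R)", OF _ _ assms(2) _ assms(1)])
  show "bilinear ((*\<^sub>R) :: real \<Rightarrow> 'a \<Rightarrow> 'a)"
    by (simp add: bilinear_conv_bounded_bilinear bounded_bilinear_scaleR)
  show "periodic_bernoulli n \<in> borel_measurable (lebesgue_on S)"
    by (intro measurable_restrict_space1 measurable_completion) simp
  show "bounded (periodic_bernoulli n ` S)"
    by (rule bounded_subset[OF bounded_range_periodic_bernoulli]) auto
qed

section \<open>Euler-Maclaurin summation, first finite and then infinite\<close>

text \<open>The trapezoidal terms add up to the sum over \<open>n < N\<close>, which omits the right
  end point, plus half the difference of the end values. Integrating the difference as a whole
  avoids assuming integrability of \<open>g (2*m)\<close>.\<close>

lemma euler_maclaurin: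
  fixes g :: "nat \<Rightarrow> real \<Rightarrow> 'a::euclidean_space"
  assumes "m \<ge> 1"
    and deriv: "\<And>j t. j < 2*m \<Longrightarrow> t \<ge> 0 \<Longrightarrow>
             (g j has_vector_derivative g (Suc j) t) (at t within {0..})"
  shows "((\<lambda>t. g 0 t - (periodic_bernoulli (2*m) t / fact (2*m)) *\<^sub>R g (2*m) t) has_integral
           (\<Sum>n<N. g 0 (real n)) + (1 / 2) *\<^sub>R (g 0 (real N) - g 0 0)
           - (\<Sum>k=1..m. (bernoulli (2*k) / fact (2*k)) *\<^sub>R (g (2*k-1) (real N) - g (2*k-1) 0)))
         {0..real N}"
proof (induction N)
  case 0
  show ?case by (simp add: has_integral_refl)
next
  case (Suc N)
  let ?R = "{real N..real N + 1}"
  have "((\<lambda>t. g 0 t - ((-1) ^ (2*m) * bernpoly (2*m) (t - real N) / fact (2*m)) *\<^sub>R g (2*m) t)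
      has_integral (1 / 2) *\<^sub>R (g 0 (real N) + g 0 (real N + 1))
        - (\<Sum>k=1..m. (bernoulli (2*k) / fact (2*k)) *\<^sub>R (g (2*k-1) (real N + 1) - g (2*k-1) (real N)))) ?R"
    unfolding bernpoly_boundary_terms_eq[OF \<open>m \<ge> 1\<close>, of "\<lambda>j. g j (real N + 1)" "\<lambda>j. g j (real N)", symmetric]
    by (intro bernpoly_repeated_integration_by_parts)
       (auto intro: has_vector_derivative_within_subset[OF deriv])
  then have step: "((\<lambda>t. g 0 t - (periodic_bernoulli (2*m) t / fact (2*m)) *\<^sub>R g (2*m) t)
      has_integral (1 / 2) *\<^sub>R (g 0 (real N) + g 0 (real N + 1))
        - (\<Sum>k=1..m. (bernoulli (2*k) / fact (2*k)) *\<^sub>R (g (2*k-1) (real N + 1) - g (2*k-1) (real N)))) ?R"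
    by (rule has_integral_eq[rotated]) (use \<open>m \<ge> 1\<close> in \<open>simp add: periodic_bernoulli_eq\<close>)
  have eq: "{0..real (Suc N)} = {0..real N + 1}" "real (Suc N) = real N + 1"
    by (simp_all add: add.commute)
  show ?case
    unfolding eq
    by (rule has_integral_eq_rhs[OF has_integral_combine[OF _ _ Suc step]])
       (auto simp: algebra_simps sum.distrib sum_subtractf simp flip: scaleR_left_distrib)
qed

lemma tendsto_integral_atLeast:
  fixes h :: "real \<Rightarrow> 'a::euclidean_space"
  assumes "h absolutely_integrable_on {a..}"
  shows "((\<lambda>b. integral {a..b} h) \<longlongrightarrow> integral {a..} h) at_top"
proof -
  have "h absolutely_integrable_on {a..b}" for b
    by (rule set_integrable_subset[OF assms]) auto
  then have "set_lebesgue_integral lebesgue {a..b} h = integral {a..b} h" for b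
    by (rule set_lebesgue_integral_eq_integral)
  then show ?thesis
    using tendsto_set_lebesgue_integral_at_top[OF _ assms] set_lebesgue_integral_eq_integral(2)[OF assms]
    by simp
qed

text \<open>The finite formula expresses the partial sums through integrals and boundary values,
  each of which has a limit.\<close>

theorem euler_maclaurin_sums:
  fixes g :: "nat \<Rightarrow> real \<Rightarrow> 'a::euclidean_space"
  assumes m: "m \<ge> 1"
    and deriv: "\<And>j t. j < 2*m \<Longrightarrow> t \<ge> 0 \<Longrightarrow>
             (g j has_vector_derivative g (Suc j) t) (at t within {0..})"
    and int_0: "g 0 absolutely_integrable_on {0..}"
    and int_2m: "g (2*m) absolutely_integrable_on {0..}"
    and lim: "\<And>j. j < 2*m \<Longrightarrow> (g j \<longlongrightarrow> 0) at_top"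
  shows "(\<lambda>n. g 0 (real n)) sums
           (integral {0..} (g 0) + (1 / 2) *\<^sub>R g 0 0
            - (\<Sum>k=1..m. (bernoulli (2*k) / fact (2*k)) *\<^sub>R g (2*k-1) 0)
            - (1 / fact (2*m)) *\<^sub>R integral {0..} (\<lambda>t. periodic_bernoulli (2*m) t *\<^sub>R g (2*m) t))"
    (is "_ sums ?s")
proof -
  let ?r = "\<lambda>t. periodic_bernoulli (2*m) t *\<^sub>R g (2*m) t"
  let ?c = "\<lambda>k. bernoulli (2*k) / fact (2*k)"
  have int_r: "?r absolutely_integrable_on {0..}"
    by (rule absolutely_integrable_periodic_bernoulli[OF int_2m]) auto
  have "(\<Sum>n<N. g 0 (real n)) = integral {0..real N} (g 0) + (1 / 2) *\<^sub>R (g 0 0 - g 0 (real N))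
      - (\<Sum>k=1..m. ?c k *\<^sub>R (g (2*k-1) 0 - g (2*k-1) (real N)))
      - (1 / fact (2*m)) *\<^sub>R integral {0..real N} ?r" for N
  proof -
    have "g 0 absolutely_integrable_on {0..real N}" "?r absolutely_integrable_on {0..real N}"
      by (auto intro!: set_integrable_subset[OF int_0] set_integrable_subset[OF int_r])
    then have "g 0 integrable_on {0..real N}" "?r integrable_on {0..real N}"
      by (auto dest: set_lebesgue_integral_eq_integral(1))
    then have "((\<lambda>t. g 0 t - (1 / fact (2*m)) *\<^sub>R ?r t) has_integral
        (integral {0..real N} (g 0) - (1 / fact (2*m)) *\<^sub>R integral {0..real N} ?r)) {0..real N}"
      by (intro has_integral_diff has_integral_cmul integrable_integral)
    with euler_maclaurin[of m g N, OF m deriv]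
    have "(\<Sum>n<N. g 0 (real n)) + (1 / 2) *\<^sub>R (g 0 (real N) - g 0 0)
           - (\<Sum>k=1..m. ?c k *\<^sub>R (g (2*k-1) (real N) - g (2*k-1) 0))
         = integral {0..real N} (g 0) - (1 / fact (2*m)) *\<^sub>R integral {0..real N} ?r"
      by (intro has_integral_unique) auto
    then show ?thesis
      by (simp add: algebra_simps sum_subtractf)
  qed
  \<comment> \<open>The boundary terms at \<open>N\<close> involve only the orders 0 and
    \<open>2*k-1\<close> with \<open>k \<le> m\<close>, all below \<open>2*m\<close>, so they vanish
    in the limit.\<close>
  moreover have "(\<lambda>N. integral {0..real N} (g 0) + (1 / 2) *\<^sub>R (g 0 0 - g 0 (real N))
      - (\<Sum>k=1..m. ?c k *\<^sub>R (g (2*k-1) 0 - g (2*k-1) (real N)))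
      - (1 / fact (2*m)) *\<^sub>R integral {0..real N} ?r)
    \<longlonglongrightarrow> integral {0..} (g 0) + (1 / 2) *\<^sub>R (g 0 0 - 0)
      - (\<Sum>k=1..m. ?c k *\<^sub>R (g (2*k-1) 0 - 0)) - (1 / fact (2*m)) *\<^sub>R integral {0..} ?r"
    using m
    by (intro tendsto_intros filterlim_compose[OF tendsto_integral_atLeast filterlim_real_sequentially]
        filterlim_compose[OF lim filterlim_real_sequentially] int_0 int_r) auto
  ultimately show ?thesis
    by (simp add: sums_def)
qed

section \<open>Application to the order data of an admissible family\<close>

theorem proposition3p2:
  fixes F :: "(real \<rightharpoonup> 'a::{real_normed_field, euclidean_space}) set"
    and D :: "real \<Rightarrow> (real \<rightharpoonup> 'a) \<Rightarrow> (real \<rightharpoonup> 'a)"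
    and f :: "real \<rightharpoonup> 'a"
    and x :: real and m :: nat
  assumes "admissible F D f"
    and "x > 0" and "m \<ge> 1"
    and "cont_diff_on {0..} (2 * m) (\<lambda>r. phi D f r x)"
    and "(\<lambda>r. phi D f r x) absolutely_integrable_on {0..}"
    and "(\<lambda>r. phi_deriv (2 * m) D f r x) absolutely_integrable_on {0..}"
    and "summable (\<lambda>n. phi D f (real n) x)"
    and "\<And>j. j \<le> 2 * m - 1 \<Longrightarrow> ((\<lambda>r. phi_deriv j D f r x) \<longlongrightarrow> 0) at_top"
  shows "((\<Sum>n. phi D f (real n) x) =
           integral {0..} (\<lambda>r. phi D f r x) + (1 / 2) *\<^sub>R phi D f 0 x
           - (\<Sum>k=1..m. (bernoulli (2 * k) / fact (2 * k)) *\<^sub>R phi_deriv (2 * k - 1) D f 0 x)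
           + remainder m D f x) \<and>
        (x \<in> dom f \<and>
         (\<lambda>n. (x ^ n / fact n) *\<^sub>R nth_deriv UNIV n (the \<circ> f) 0) sums the (f x) \<longrightarrow>
         the (f x) =
           spectral_reconstruction D f x + (1 / 2) *\<^sub>R the (f 0)
           - (\<Sum>k=1..m. (bernoulli (2 * k) / fact (2 * k)) *\<^sub>R phi_deriv (2 * k - 1) D f 0 x)
           + remainder m D f x)"
proof -
  let ?g = "\<lambda>j r. phi_deriv j D f r x"
  have g_0: "?g 0 = (\<lambda>r. phi D f r x)"
    by (simp add: nth_deriv_def)
  \<comment> \<open>Differentiability relative to \<open>{0..}\<close> makes the total
    \<open>vector_derivative\<close> an actual derivative, one-sided at 0.\<close>
  have deriv: "(?g j has_vector_derivative ?g (Suc j) t) (at t within {0..})"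
    if "j < 2 * m" "t \<ge> 0" for j t
  proof -
    have "?g j differentiable (at t within {0..})"
      using assms(4) that unfolding cont_diff_on_def by (metis atLeast_iff)
    moreover have "?g (Suc j) t = vector_derivative (?g j) (at t within {0..})"
      by (simp add: nth_deriv_def)
    ultimately show ?thesis
      by (simp only: vector_derivative_works)
  qed
  have lim: "(?g j \<longlongrightarrow> 0) at_top" if "j < 2 * m" for j
    using that by (intro assms(8)) simp
  have "?g 0 absolutely_integrable_on {0..}"
    unfolding g_0 by (rule assms(5))
  from euler_maclaurin_sums[of m ?g, OF \<open>m \<ge> 1\<close> deriv this assms(6) lim]
  have sums: "(\<lambda>n. phi D f (real n) x) sums
      (integral {0..} (\<lambda>r. phi D f r x) + (1 / 2) *\<^sub>R phi D f 0 x
       - (\<Sum>k=1..m. (bernoulli (2 * k) / fact (2 * k)) *\<^sub>R phi_deriv (2 * k - 1) D f 0 x)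
       + remainder m D f x)"
    by (simp add: g_0 remainder_def)
  have at_0: "the (D (real n) f 0) = nth_deriv UNIV n (the \<circ> f) 0" for n
    using assms(1) by (simp add: admissible_def)
  \<comment> \<open>At integer orders the real power is an ordinary one and
    \<open>Gamma (n + 1)\<close> is \<open>fact n\<close>.\<close>
  have "phi D f (real n) x = (x ^ n / fact n) *\<^sub>R nth_deriv UNIV n (the \<circ> f) 0" for n
    using \<open>x > 0\<close> at_0[of n]
    by (simp add: phi_def powr_realpow Gamma_fact add.commute)
  with sums have maclaurin: "(\<lambda>n. (x ^ n / fact n) *\<^sub>R nth_deriv UNIV n (the \<circ> f) 0) sums
      (integral {0..} (\<lambda>r. phi D f r x) + (1 / 2) *\<^sub>R phi D f 0 x
       - (\<Sum>k=1..m. (bernoulli (2 * k) / fact (2 * k)) *\<^sub>R phi_deriv (2 * k - 1) D f 0 x)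
       + remainder m D f x)"
    by simp
  \<comment> \<open>Order 0 of the agreement with classical derivatives, with
    \<open>x powr 0 = 1\<close> and \<open>Gamma 1 = 1\<close>.\<close>
  have phi_0: "phi D f 0 x = the (f 0)"
    using \<open>x > 0\<close> at_0[of 0] by (simp add: phi_def nth_deriv_def)
  show ?thesis
    unfolding spectral_reconstruction_def phi_0 [symmetric]
    \<comment> \<open>For the second claim, the Maclaurin series sums both to
      \<open>the (f x)\<close> and to the right-hand side, and a sum is unique.\<close>
    using sums_unique[OF sums, symmetric] sums_unique2[OF _ maclaurin] by blast
qed

end
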